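(* If $(A,D)$ is a regular MASA inclusion, then every approximate unit for $D$ is an approximate unit for $A$.
   Context: An inclusion is a pair $(A,D)$ where $A$ and $D$ are $C^*$-algebras (not assumed unital), $D$ is abelian, and $D\subseteq A$ is a $C^*$-subalgebra. The set of normalizers is $N(A,D):=\{n\in A: nDn^*\cup n^*Dn\subseteq D\}$. The inclusion $(A,D)$ is regular if the linear span of $N(A,D)$ is norm-dense in $A$, and it is a MASA inclusion if $D$ is maximal abelian in $A$. An approximate unit for $D$ is, as usual, a net $(u_\lambda)$ of positive elements of $D$ with $\|u_\lambda\|\le 1$ such that $u_\lambda d\to d$ in norm for all $d\in D$; such a net is an approximate unit for $A$ if $u_\lambda a\to a$ and $au_\lambda\to a$ in norm for all $a\in A$. *)

theory Defs
  imports "HOL-Analysis.Analysis"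
begin

section \<open>C*-algebras\<close>

class scaleC =
  fixes scaleC :: "complex \<Rightarrow> 'a \<Rightarrow> 'a"  (infixr \<open>*\<^sub>C\<close> 75)

class adjoint =
  fixes adj :: "'a \<Rightarrow> 'a"  (\<open>(_\<^sup>\<star>)\<close> [1000] 999)

text \<open>No unit is assumed: the base class is \<^class>\<open>real_normed_algebra\<close>, not
  \<^class>\<open>real_normed_algebra_1\<close>.\<close>

class cstar_algebra = real_normed_algebra + banach + scaleC + adjoint +
  assumes scaleR_scaleC: "r *\<^sub>R x = complex_of_real r *\<^sub>C x"
    and scaleC_add_right: "c *\<^sub>C (x + y) = c *\<^sub>C x + c *\<^sub>C y"
    and scaleC_add_left: "(c + d) *\<^sub>C x = c *\<^sub>C x + d *\<^sub>C x"
    and scaleC_scaleC: "c *\<^sub>C d *\<^sub>C x = (c * d) *\<^sub>C x"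
    and mult_scaleC_left: "(c *\<^sub>C x) * y = c *\<^sub>C (x * y)"
    and mult_scaleC_right: "x * (c *\<^sub>C y) = c *\<^sub>C (x * y)"
    and norm_scaleC: "norm (c *\<^sub>C x) = cmod c * norm x"
    and adj_add: "(x + y)\<^sup>\<star> = x\<^sup>\<star> + y\<^sup>\<star>"
    and adj_scaleC: "(c *\<^sub>C x)\<^sup>\<star> = cnj c *\<^sub>C x\<^sup>\<star>"
    and adj_mult: "(x * y)\<^sup>\<star> = y\<^sup>\<star> * x\<^sup>\<star>"
    and adj_adj: "(x\<^sup>\<star>)\<^sup>\<star> = x"
    and cstar_identity: "norm (x\<^sup>\<star> * x) = (norm x)\<^sup>2"

lemma scaleC_one: "1 *\<^sub>C x = (x :: 'a :: cstar_algebra)"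
  using scaleR_scaleC[of 1 x] by simp

global_interpretation cmodule: vector_space "scaleC :: complex \<Rightarrow> 'a \<Rightarrow> 'a :: cstar_algebra"
  defines csubspace = cmodule.subspace
    and cspan = cmodule.span
  by unfold_locales
    (simp_all add: scaleC_add_right scaleC_add_left scaleC_scaleC scaleC_one)

instantiation complex :: cstar_algebra
begin

definition scaleC_complex :: "complex \<Rightarrow> complex \<Rightarrow> complex"
  where "scaleC_complex c z = c * z"

definition adj_complex :: "complex \<Rightarrow> complex"
  where "adj_complex z = cnj z"

instance
  by standard
    (simp_all add: scaleC_complex_def adj_complex_def scaleR_conv_of_real algebra_simps
      norm_mult power2_eq_square)

end

definition cstar_subalgebra :: "'a :: cstar_algebra set \<Rightarrow> bool"
  where "cstar_subalgebra B \<longleftrightarrow>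
    csubspace B \<and> closed B \<and> (\<forall>x\<in>B. \<forall>y\<in>B. x * y \<in> B) \<and> (\<forall>x\<in>B. x\<^sup>\<star> \<in> B)"

definition abelian :: "'a :: cstar_algebra set \<Rightarrow> bool"
  where "abelian B \<longleftrightarrow> (\<forall>x\<in>B. \<forall>y\<in>B. x * y = y * x)"


section \<open>Positive elements\<close>

text \<open>The pair \<open>(a, z)\<close> stands for the element \<open>a + z1\<close> of the unitization; the unit
  is \<open>(0, 1)\<close>.\<close>

definition unitization_mult ::
    "'a :: cstar_algebra \<times> complex \<Rightarrow> 'a \<times> complex \<Rightarrow> 'a \<times> complex"
  where "unitization_mult p q =
    (fst p * fst q + snd p *\<^sub>C fst q + snd q *\<^sub>C fst p, snd p * snd q)"

text \<open>The spectrum of \<open>a\<close> relative to the C*-subalgebra \<open>B\<close>, computed in the unitization of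
  \<open>B\<close>. When \<open>B\<close> already has a unit this adds at most the point \<open>0\<close> to the usual spectrum, which
  is immaterial for positivity.\<close>

definition spectrum_in :: "'a :: cstar_algebra set \<Rightarrow> 'a \<Rightarrow> complex set"
  where "spectrum_in B a = {z. \<not> (\<exists>q \<in> B \<times> UNIV.
    unitization_mult (a, - z) q = (0, 1) \<and> unitization_mult q (a, - z) = (0, 1))}"

definition positive_in :: "'a :: cstar_algebra set \<Rightarrow> 'a \<Rightarrow> bool"
  where "positive_in B a \<longleftrightarrow> a \<in> B \<and> a\<^sup>\<star> = a \<and> spectrum_in B a \<subseteq> \<real>\<^sub>\<ge>\<^sub>0"


section \<open>Inclusions\<close>

text \<open>In a pair \<open>(A, D)\<close> the algebra \<open>A\<close> is the whole type \<^typ>\<open>'a\<close>.\<close>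

definition inclusion :: "'a :: cstar_algebra set \<Rightarrow> bool"
  where "inclusion D \<longleftrightarrow> cstar_subalgebra D \<and> abelian D"

definition normalizers :: "'a :: cstar_algebra set \<Rightarrow> 'a set"
  where "normalizers D =
    {n. (\<lambda>d. n * d * n\<^sup>\<star>) ` D \<union> (\<lambda>d. n\<^sup>\<star> * d * n) ` D \<subseteq> D}"

definition regular_inclusion :: "'a :: cstar_algebra set \<Rightarrow> bool"
  where "regular_inclusion D \<longleftrightarrow> inclusion D \<and> closure (cspan (normalizers D)) = UNIV"

definition masa_inclusion :: "'a :: cstar_algebra set \<Rightarrow> bool"
  where "masa_inclusion D \<longleftrightarrow> inclusion D \<and>
    (\<forall>B. cstar_subalgebra B \<and> abelian B \<and> D \<subseteq> B \<longrightarrow> B = D)"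


section \<open>Nets and approximate units\<close>

definition directed_set :: "'i set \<Rightarrow> ('i \<Rightarrow> 'i \<Rightarrow> bool) \<Rightarrow> bool"
  where "directed_set I le \<longleftrightarrow> I \<noteq> {} \<and> (\<forall>i\<in>I. le i i) \<and>
    (\<forall>i\<in>I. \<forall>j\<in>I. \<forall>k\<in>I. le i j \<longrightarrow> le j k \<longrightarrow> le i k) \<and>
    (\<forall>i\<in>I. \<forall>j\<in>I. \<exists>k\<in>I. le i k \<and> le j k)"

text \<open>Convergence of a net is convergence along the filter generated by its tails.\<close>

definition tails :: "'i set \<Rightarrow> ('i \<Rightarrow> 'i \<Rightarrow> bool) \<Rightarrow> 'i filter"
  where "tails I le = (INF i\<in>I. principal {j \<in> I. le i j})"

lemma eventually_tails:
  assumes "directed_set I le"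
  shows "eventually P (tails I le) \<longleftrightarrow> (\<exists>i\<in>I. \<forall>j\<in>I. le i j \<longrightarrow> P j)"
proof -
  have "eventually P (tails I le) \<longleftrightarrow>
      (\<exists>i\<in>I. eventually P (principal {j \<in> I. le i j}))"
    unfolding tails_def
  proof (rule eventually_INF_base)
    show "I \<noteq> {}"
      using assms by (simp add: directed_set_def)
    fix i j assume ij: "i \<in> I" "j \<in> I"
    then obtain k where k: "k \<in> I" "le i k" "le j k"
      using assms unfolding directed_set_def by blast
    have "{l \<in> I. le k l} \<subseteq> {l \<in> I. le i l} \<inter> {l \<in> I. le j l}"
      using assms ij k unfolding directed_set_def by blast
    with k show "\<exists>k\<in>I. principal {l \<in> I. le k l} \<le>
        inf (principal {l \<in> I. le i l}) (principal {l \<in> I. le j l})"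
      by auto
  qed
  then show ?thesis
    by (auto simp: eventually_principal)
qed

definition positive_contractive_net ::
    "'a :: cstar_algebra set \<Rightarrow> 'i set \<Rightarrow> ('i \<Rightarrow> 'i \<Rightarrow> bool) \<Rightarrow> ('i \<Rightarrow> 'a) \<Rightarrow> bool"
  where "positive_contractive_net B I le u \<longleftrightarrow>
    directed_set I le \<and> (\<forall>i\<in>I. positive_in B (u i) \<and> norm (u i) \<le> 1)"

definition approximate_unit_subalgebra ::
    "'a :: cstar_algebra set \<Rightarrow> 'i set \<Rightarrow> ('i \<Rightarrow> 'i \<Rightarrow> bool) \<Rightarrow> ('i \<Rightarrow> 'a) \<Rightarrow> bool"
  where "approximate_unit_subalgebra D I le u \<longleftrightarrow> positive_contractive_net D I le u \<and>
    (\<forall>d\<in>D. ((\<lambda>i. u i * d) \<longlongrightarrow> d) (tails I le))"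

definition approximate_unit_algebra ::
    "'i set \<Rightarrow> ('i \<Rightarrow> 'i \<Rightarrow> bool) \<Rightarrow> ('i \<Rightarrow> 'a :: cstar_algebra) \<Rightarrow> bool"
  where "approximate_unit_algebra I le u \<longleftrightarrow> positive_contractive_net UNIV I le u \<and>
    (\<forall>a. ((\<lambda>i. u i * a) \<longlongrightarrow> a) (tails I le) \<and> ((\<lambda>i. a * u i) \<longlongrightarrow> a) (tails I le))"

end

theory Submission
  imports Defs
begin

text \<open>
  Write \<open>(u\<^sub>i)\<close> for the approximate unit of \<open>D\<close>. Everything rests on the \<open>C\<^sup>*\<close>-identity in
  the following form: if \<open>x\<^sup>\<star> x\<close> lies in \<open>D\<close>, then
  \<open>\<parallel>x - x u\<^sub>i\<parallel>\<^sup>2 = \<parallel>(1 - u\<^sub>i) x\<^sup>\<star> x (1 - u\<^sub>i)\<parallel> \<rightarrow> 0\<close>, although \<open>x\<close> itself need not lie in \<open>D\<close>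
  (\<open>right_unit_limit\<close>, and \<open>left_unit_limit\<close> for \<open>x x\<^sup>\<star> \<in> D\<close>). Hence the theorem follows once
  \<open>n\<^sup>\<star> n \<in> D\<close> for every normalizer \<open>n\<close>: then \<open>u\<^sub>i n \<rightarrow> n\<close> (apply this to the normalizer \<open>n\<^sup>\<star>\<close>), the
  convergence passes to the closed linear span of the normalizers, which is the whole algebra, and
  the other side is obtained by taking adjoints.

  As \<open>D\<close> is maximal abelian, it contains every self-adjoint element that commutes with it, so it
  is enough that \<open>p = n\<^sup>\<star> n\<close> commutes with \<open>D\<close>. If \<open>D\<close> had a unit that was also a unit for \<open>n\<close>,
  then \<open>p = n\<^sup>\<star> 1 n\<close> would be in \<open>D\<close> at once. The approximate unit replaces this unit in two steps.
  For \<open>h, k \<in> D\<close> the element \<open>x = n k\<close> satisfies \<open>x x\<^sup>\<star> = n k k\<^sup>\<star> n\<^sup>\<star> \<in> D\<close>, so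
  \<open>h p k = lim h n\<^sup>\<star> u\<^sub>i n k \<in> D\<close>. The element \<open>x = h p\<close> satisfies
  \<open>x\<^sup>\<star> x = n\<^sup>\<star> (n h\<^sup>\<star> h n\<^sup>\<star>) n \<in> D\<close>, so \<open>h p = lim h p u\<^sub>i \<in> D\<close>. So \<open>p\<close> multiplies \<open>D\<close> into the
  abelian algebra \<open>D\<close>, and this forces \<open>p\<close> to commute with \<open>D\<close>.
\<close>

section \<open>The adjoint\<close>

lemma adj_diff: "(x - y)\<^sup>\<star> = x\<^sup>\<star> - (y\<^sup>\<star> :: 'a :: cstar_algebra)"
  using adj_add[of "x - y" y] by (simp add: algebra_simps)

lemma adj_zero: "0\<^sup>\<star> = (0 :: 'a :: cstar_algebra)"
  using adj_diff[of 0 "0 :: 'a"] by simp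

lemma norm_adj: "norm (x\<^sup>\<star>) = norm (x :: 'a :: cstar_algebra)"
proof -
  have le: "norm y \<le> norm (y\<^sup>\<star>)" for y :: 'a
  proof (cases "y = 0")
    case False
    have "norm y * norm y \<le> norm (y\<^sup>\<star>) * norm y"
      using cstar_identity[of y] norm_mult_ineq[of "y\<^sup>\<star>" y] by (simp add: power2_eq_square)
    with False show ?thesis by simp
  qed (simp add: adj_zero)
  show ?thesis
    using le[of x] le[of "x\<^sup>\<star>"] by (simp add: adj_adj)
qed

lemma tendsto_adj:
  fixes f :: "'i \<Rightarrow> 'a :: cstar_algebra"
  assumes "(f \<longlongrightarrow> a) F"
  shows "((\<lambda>i. (f i)\<^sup>\<star>) \<longlongrightarrow> a\<^sup>\<star>) F"
  using assms by (simp add: tendsto_iff dist_norm adj_diff[symmetric] norm_adj)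


section \<open>Commutants and maximal abelian subalgebras\<close>

definition commutant :: "'a :: times set \<Rightarrow> 'a set"
  where "commutant S = {x. \<forall>s\<in>S. x * s = s * x}"

lemma commutantD: "x \<in> commutant S \<Longrightarrow> s \<in> S \<Longrightarrow> x * s = s * x"
  by (simp add: commutant_def)

lemma subset_double_commutant: "S \<subseteq> commutant (commutant S)"
proof
  fix t assume t: "t \<in> S"
  have "t * s = s * t" if "s \<in> commutant S" for s
    by (rule commutantD[OF that t, symmetric])
  then show "t \<in> commutant (commutant S)"
    by (simp add: commutant_def[of "commutant S"])
qed

lemma cstar_subalgebra_commutant:
  fixes S :: "'a :: cstar_algebra set"
  assumes adj_closed: "\<And>s. s \<in> S \<Longrightarrow> s\<^sup>\<star> \<in> S"
  shows "cstar_subalgebra (commutant S)"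
  unfolding cstar_subalgebra_def
proof (intro conjI ballI)
  show "csubspace (commutant S)"
    unfolding commutant_def
    by (rule cmodule.subspaceI)
      (simp_all add: distrib_left distrib_right mult_scaleC_left mult_scaleC_right)
  have "commutant S = (\<Inter>s\<in>S. {x. x * s = s * x})"
    by (auto simp: commutant_def)
  then show "closed (commutant S)"
    by (simp only:) (intro closed_INT ballI closed_Collect_eq continuous_intros)
next
  fix x y assume "x \<in> commutant S" "y \<in> commutant S"
  then have "x * y * s = s * (x * y)" if "s \<in> S" for s
    using that by (metis commutantD mult.assoc)
  then show "x * y \<in> commutant S"
    by (simp add: commutant_def)
next
  fix x assume x: "x \<in> commutant S"
  have "x\<^sup>\<star> * s = s * x\<^sup>\<star>" if "s \<in> S" for s
    using arg_cong[OF commutantD[OF x adj_closed[OF that]], of adj]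
    by (simp add: adj_mult adj_adj)
  then show "x\<^sup>\<star> \<in> commutant S"
    by (simp add: commutant_def)
qed

text \<open>Let \<open>S = D \<union> {p}\<close>. Its elements commute with each other, so \<open>S\<close> lies in its commutant
  \<open>S'\<close>; hence \<open>S'' \<subseteq> S'\<close>, which says that the \<open>C\<^sup>*\<close>-subalgebra \<open>S''\<close> is abelian. It contains
  \<open>S\<close>, so maximality of \<open>D\<close> gives \<open>p \<in> S'' = D\<close>. The double commutant thus stands in for the
  \<open>C\<^sup>*\<close>-subalgebra generated by \<open>S\<close>.\<close>

lemma masa_inclusion_memI:
  fixes D :: "'a :: cstar_algebra set"
  assumes masa: "masa_inclusion D"
    and self_adjoint: "p\<^sup>\<star> = p"
    and commute: "\<And>d. d \<in> D \<Longrightarrow> p * d = d * p"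
  shows "p \<in> D"
proof -
  define S where "S = insert p D"
  have D: "cstar_subalgebra D" "abelian D"
    using masa by (auto simp: masa_inclusion_def inclusion_def)
  have S_adj: "s\<^sup>\<star> \<in> S" if "s \<in> S" for s
    using that D(1) self_adjoint unfolding S_def cstar_subalgebra_def by blast
  have S': "S \<subseteq> commutant S"
    unfolding S_def commutant_def using D(2) commute commute[symmetric]
    by (auto simp only: abelian_def)
  have S'': "S \<subseteq> commutant (commutant S)"
    by (rule subset_double_commutant)
  have "cstar_subalgebra (commutant (commutant S))"
    using cstar_subalgebra_commutant[OF S_adj] unfolding cstar_subalgebra_def[of "commutant S"]
    by (intro cstar_subalgebra_commutant) blast
  moreover have "abelian (commutant (commutant S))"
    unfolding abelian_def
  proof (intro ballI)
    fix x y assume x: "x \<in> commutant (commutant S)" and y: "y \<in> commutant (commutant S)"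
    have "y \<in> commutant S"
      using commutantD[OF y subsetD[OF S']] unfolding commutant_def by blast
    then show "x * y = y * x"
      by (rule commutantD[OF x])
  qed
  ultimately have "commutant (commutant S) = D"
    using masa S'' unfolding masa_inclusion_def S_def by blast
  then show ?thesis
    using S'' unfolding S_def by blast
qed


section \<open>Approximate units and normalizers\<close>

locale inclusion_with_approximate_unit =
  fixes D :: "'a :: cstar_algebra set"
    and I :: "'i set" and le :: "'i \<Rightarrow> 'i \<Rightarrow> bool" and u :: "'i \<Rightarrow> 'a"
  assumes inclusion: "inclusion D"
    and approximate_unit: "approximate_unit_subalgebra D I le u"
begin

lemma mult_mem: "x \<in> D \<Longrightarrow> y \<in> D \<Longrightarrow> x * y \<in> D"
  and adj_mem: "x \<in> D \<Longrightarrow> x\<^sup>\<star> \<in> D"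
  and closed_D: "closed D"
  and commute: "x \<in> D \<Longrightarrow> y \<in> D \<Longrightarrow> x * y = y * x"
  using inclusion unfolding inclusion_def cstar_subalgebra_def abelian_def by blast+

lemma directed: "directed_set I le"
  and unit_limit: "d \<in> D \<Longrightarrow> ((\<lambda>i. u i * d) \<longlongrightarrow> d) (tails I le)"
  and unit_mem: "i \<in> I \<Longrightarrow> u i \<in> D"
  and adj_unit: "i \<in> I \<Longrightarrow> (u i)\<^sup>\<star> = u i"
  and norm_unit: "i \<in> I \<Longrightarrow> norm (u i) \<le> 1"
  using approximate_unit
  by (auto simp: approximate_unit_subalgebra_def positive_contractive_net_def positive_in_def)

lemma eventually_index: "eventually (\<lambda>i. i \<in> I) (tails I le)"
  and tails_nontrivial: "tails I le \<noteq> bot"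
proof -
  obtain i where "i \<in> I"
    using directed unfolding directed_set_def by blast
  then show "eventually (\<lambda>i. i \<in> I) (tails I le)"
    unfolding eventually_tails[OF directed] by blast
  have "\<forall>i\<in>I. le i i"
    using directed unfolding directed_set_def by blast
  then show "tails I le \<noteq> bot"
    unfolding trivial_limit_def eventually_tails[OF directed] by blast
qed

lemma mem_of_limit:
  assumes "(f \<longlongrightarrow> x) (tails I le)" "\<And>i. i \<in> I \<Longrightarrow> f i \<in> D"
  shows "x \<in> D"
  using closed_D eventually_mono[OF eventually_index assms(2)] tails_nontrivial assms(1)
  by (rule Lim_in_closed_set)

text \<open>With \<open>d = x\<^sup>\<star> x\<close> and \<open>r = u\<^sub>i d - d\<close>, the \<open>C\<^sup>*\<close>-identity and commutativity of \<open>D\<close> give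
  \<open>\<parallel>x u\<^sub>i - x\<parallel>\<^sup>2 = \<parallel>u\<^sub>i r - r\<parallel> \<le> 2 \<parallel>r\<parallel>\<close>, which tends to \<open>0\<close> because \<open>d\<close>, unlike \<open>x\<close>, is
  known to lie in \<open>D\<close>.\<close>

lemma right_unit_limit:
  assumes "x\<^sup>\<star> * x \<in> D"
  shows "((\<lambda>i. x * u i) \<longlongrightarrow> x) (tails I le)"
proof -
  define d where "d = x\<^sup>\<star> * x"
  have bound: "norm (x * u i - x) \<le> sqrt (2 * norm (u i * d - d))" if i: "i \<in> I" for i
  proof (rule real_le_rsqrt)
    have "(x * u i - x)\<^sup>\<star> * (x * u i - x) = u i * (d * u i - d) - (d * u i - d)"
      by (simp add: adj_diff adj_mult adj_unit[OF i] d_def algebra_simps)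
    also have "d * u i = u i * d"
      using commute unit_mem[OF i] assms by (simp add: d_def)
    finally have "(norm (x * u i - x))\<^sup>2 = norm (u i * (u i * d - d) - (u i * d - d))"
      by (simp flip: cstar_identity)
    also have "\<dots> \<le> norm (u i) * norm (u i * d - d) + norm (u i * d - d)"
      by (rule order_trans[OF norm_triangle_ineq4]) (simp add: norm_mult_ineq)
    also have "\<dots> \<le> 2 * norm (u i * d - d)"
      using mult_right_mono[OF norm_unit[OF i], of "norm (u i * d - d)"] by simp
    finally show "(norm (x * u i - x))\<^sup>2 \<le> 2 * norm (u i * d - d)" .
  qed
  have "((\<lambda>i. norm (u i * d - d)) \<longlongrightarrow> 0) (tails I le)"
    using unit_limit[OF assms] by (simp add: d_def tendsto_norm_zero_iff LIM_zero_iff)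
  then have "((\<lambda>i. sqrt (2 * norm (u i * d - d))) \<longlongrightarrow> sqrt (2 * 0)) (tails I le)"
    by (intro tendsto_intros)
  then have "((\<lambda>i. x * u i - x) \<longlongrightarrow> 0) (tails I le)"
    by (intro Lim_null_comparison[OF eventually_mono[OF eventually_index bound]]) auto
  then show ?thesis
    by (simp add: LIM_zero_iff)
qed

lemma left_unit_limit:
  assumes "x * x\<^sup>\<star> \<in> D"
  shows "((\<lambda>i. u i * x) \<longlongrightarrow> x) (tails I le)"
proof -
  have "((\<lambda>i. (x\<^sup>\<star> * u i)\<^sup>\<star>) \<longlongrightarrow> x) (tails I le)"
    using tendsto_adj[OF right_unit_limit[of "x\<^sup>\<star>"], unfolded adj_adj, OF assms] .
  moreover have "eventually (\<lambda>i. (x\<^sup>\<star> * u i)\<^sup>\<star> = u i * x) (tails I le)"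
    by (rule eventually_mono[OF eventually_index]) (simp add: adj_mult adj_adj adj_unit)
  ultimately show ?thesis
    by (rule Lim_transform_eventually)
qed

lemma normalizer_conj_mem:
  assumes "n \<in> normalizers D" "d \<in> D"
  shows "n * d * n\<^sup>\<star> \<in> D" "n\<^sup>\<star> * d * n \<in> D"
  using assms by (simp_all add: normalizers_def image_subset_iff)

text \<open>The factor \<open>k\<close> is what makes \<open>u\<^sub>i\<close> converge to a unit on \<open>n k\<close>: \<open>n k (n k)\<^sup>\<star>\<close> is a conjugate
  of an element of \<open>D\<close>, whereas nothing is known yet about \<open>n n\<^sup>\<star>\<close>. So \<open>u\<^sub>i\<close> can be inserted
  between \<open>n\<^sup>\<star>\<close> and \<open>n\<close>, and \<open>n\<^sup>\<star> u\<^sub>i n\<close> is in \<open>D\<close>.\<close>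

lemma normalizer_compress_mem:
  assumes n: "n \<in> normalizers D" and h: "h \<in> D" and k: "k \<in> D"
  shows "h * (n\<^sup>\<star> * n) * k \<in> D"
proof (rule mem_of_limit)
  have "n * k * (n * k)\<^sup>\<star> \<in> D"
    using normalizer_conj_mem(1)[OF n mult_mem[OF k adj_mem[OF k]]]
    by (simp add: adj_mult mult.assoc)
  then have "((\<lambda>i. h * n\<^sup>\<star> * (u i * (n * k))) \<longlongrightarrow> h * n\<^sup>\<star> * (n * k)) (tails I le)"
    by (intro tendsto_intros left_unit_limit)
  then show "((\<lambda>i. h * (n\<^sup>\<star> * u i * n) * k) \<longlongrightarrow> h * (n\<^sup>\<star> * n) * k) (tails I le)"
    by (simp add: mult.assoc)
  show "h * (n\<^sup>\<star> * u i * n) * k \<in> D" if "i \<in> I" for i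
    by (rule mult_mem[OF mult_mem[OF h normalizer_conj_mem(2)[OF n unit_mem[OF that]]] k])
qed

text \<open>The right factor \<open>k\<close> of the previous lemma can be removed by letting it run through
  \<open>(u\<^sub>i)\<close>: for \<open>x = h n\<^sup>\<star> n\<close>, the element \<open>x\<^sup>\<star> x\<close> is obtained from \<open>h\<^sup>\<star> h\<close> by conjugating
  with \<open>n\<close> and then with \<open>n\<^sup>\<star>\<close>, so it is in \<open>D\<close>.\<close>

lemma normalizer_mult_mem:
  assumes n: "n \<in> normalizers D" and h: "h \<in> D"
  shows "h * (n\<^sup>\<star> * n) \<in> D"
proof (rule mem_of_limit)
  have "(h * (n\<^sup>\<star> * n))\<^sup>\<star> * (h * (n\<^sup>\<star> * n)) = n\<^sup>\<star> * (n * (h\<^sup>\<star> * h) * n\<^sup>\<star>) * n"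
    by (simp add: adj_mult adj_adj mult.assoc)
  also have "\<dots> \<in> D"
    by (rule normalizer_conj_mem(2)[OF n
          normalizer_conj_mem(1)[OF n mult_mem[OF adj_mem[OF h] h]]])
  finally show "((\<lambda>i. h * (n\<^sup>\<star> * n) * u i) \<longlongrightarrow> h * (n\<^sup>\<star> * n)) (tails I le)"
    by (rule right_unit_limit)
  show "h * (n\<^sup>\<star> * n) * u i \<in> D" if "i \<in> I" for i
    by (rule normalizer_compress_mem[OF n h unit_mem[OF that]])
qed

text \<open>Taking adjoints, \<open>p\<close> also multiplies \<open>D\<close> into \<open>D\<close> from the right. Since \<open>u\<^sub>i p \<in> D\<close>
  commutes with \<open>d\<close>, and \<open>d\<close> with \<open>u\<^sub>i\<close>, one has \<open>u\<^sub>i (p d) = d (u\<^sub>i p) = u\<^sub>i (d p)\<close>; the two ends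
  converge to \<open>p d\<close> and \<open>d p\<close>, which are elements of \<open>D\<close>.\<close>

lemma self_adjoint_multiplier_commute:
  assumes self_adjoint: "p\<^sup>\<star> = p"
    and mult: "\<And>h. h \<in> D \<Longrightarrow> h * p \<in> D"
    and d: "d \<in> D"
  shows "p * d = d * p"
proof -
  have "p * d \<in> D"
    using adj_mem[OF mult[OF adj_mem[OF d]]] by (simp add: adj_mult adj_adj self_adjoint)
  then have "((\<lambda>i. u i * (p * d)) \<longlongrightarrow> p * d) (tails I le)"
    by (rule unit_limit)
  moreover have "eventually (\<lambda>i. u i * (p * d) = u i * (d * p)) (tails I le)"
  proof (rule eventually_mono[OF eventually_index])
    fix i assume i: "i \<in> I"
    have "u i * (p * d) = d * (u i * p)"
      using commute[OF mult[OF unit_mem[OF i]] d] by (simp add: mult.assoc)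
    also have "\<dots> = u i * (d * p)"
      using commute[OF d unit_mem[OF i]] by (metis mult.assoc)
    finally show "u i * (p * d) = u i * (d * p)" .
  qed
  ultimately have "((\<lambda>i. u i * (d * p)) \<longlongrightarrow> p * d) (tails I le)"
    by (rule Lim_transform_eventually)
  then show ?thesis
    using tendsto_unique[OF tails_nontrivial _ unit_limit[OF mult[OF d]]] by blast
qed

lemma normalizer_adj_mult_self_mem:
  assumes "masa_inclusion D" "n \<in> normalizers D"
  shows "n\<^sup>\<star> * n \<in> D"
proof (rule masa_inclusion_memI[OF assms(1)])
  show self_adjoint: "(n\<^sup>\<star> * n)\<^sup>\<star> = n\<^sup>\<star> * n"
    by (simp add: adj_mult adj_adj)
  show "n\<^sup>\<star> * n * d = d * (n\<^sup>\<star> * n)" if "d \<in> D" for d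
    using self_adjoint_multiplier_commute[OF self_adjoint _ that] normalizer_mult_mem assms(2)
    by blast
qed

text \<open>Contractivity of the \<open>u\<^sub>i\<close> makes the set of elements on which they act as a left approximate
  unit closed in norm.\<close>

lemma unit_limit_closure_cspan:
  assumes S: "\<And>s. s \<in> S \<Longrightarrow> ((\<lambda>i. u i * s) \<longlongrightarrow> s) (tails I le)"
    and a: "a \<in> closure (cspan S)"
  shows "((\<lambda>i. u i * a) \<longlongrightarrow> a) (tails I le)"
proof -
  let ?M = "{x. ((\<lambda>i. u i * x) \<longlongrightarrow> x) (tails I le)}"
  have scaleC_limit: "((\<lambda>i. u i * (c *\<^sub>C x)) \<longlongrightarrow> c *\<^sub>C x) (tails I le)"
    if "x \<in> ?M" for c x
  proof -
    have "((\<lambda>i. norm (u i * (c *\<^sub>C x) - c *\<^sub>C x)) \<longlongrightarrow> cmod c * 0) (tails I le)"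
      using tendsto_mult_left[of "\<lambda>i. norm (u i * x - x)" 0 "tails I le" "cmod c"] that
      by (simp add: mult_scaleC_right norm_scaleC tendsto_norm_zero_iff LIM_zero_iff
          flip: cmodule.scale_right_diff_distrib)
    then show ?thesis
      by (simp add: tendsto_norm_zero_iff LIM_zero_iff)
  qed
  have "csubspace ?M"
    by (rule cmodule.subspaceI)
      (auto simp: distrib_left scaleC_limit intro: tendsto_add)
  then have span: "cspan S \<subseteq> ?M"
    using S by (intro cmodule.span_minimal) auto
  show ?thesis
  proof (rule tendstoI)
    fix e :: real assume "e > 0"
    then obtain b where b: "b \<in> cspan S" "norm (b - a) < e / 3"
      using a unfolding closure_approachable dist_norm
      by (metis zero_less_divide_iff zero_less_numeral)
    have "eventually (\<lambda>i. norm (u i * b - b) < e / 3) (tails I le)"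
      using tendstoD[of _ b "tails I le" "e / 3"] span b \<open>e > 0\<close> by (auto simp: dist_norm)
    with eventually_index show "eventually (\<lambda>i. dist (u i * a) a < e) (tails I le)"
    proof eventually_elim
      case (elim i)
      have "norm (u i * (b - a)) \<le> norm (b - a)"
        using norm_mult_ineq[of "u i" "b - a"]
          mult_right_mono[OF norm_unit[OF elim(1)], of "norm (b - a)"] by simp
      moreover have "norm (u i * a - a) \<le>
          norm (u i * b - b) + norm (b - a) + norm (u i * (b - a))"
      proof -
        have "u i * a - a = (u i * b - b) + (b - a) - u i * (b - a)"
          by (simp add: algebra_simps)
        then have "norm (u i * a - a) \<le> norm ((u i * b - b) + (b - a)) + norm (u i * (b - a))"
          by (simp only: norm_triangle_ineq4)
        also have "\<dots> \<le> norm (u i * b - b) + norm (b - a) + norm (u i * (b - a))"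
          by (rule add_right_mono) (rule norm_triangle_ineq)
        finally show ?thesis .
      qed
      ultimately show ?case
        using elim(2) b(2) unfolding dist_norm by linarith
    qed
  qed
qed

end

lemma adj_normalizer: "n \<in> normalizers D \<Longrightarrow> n\<^sup>\<star> \<in> normalizers D"
  by (simp add: normalizers_def adj_adj Un_commute)

text \<open>An inverse in the unitization of \<open>B\<close> is an inverse in the unitization of the whole algebra,
  so the spectrum can only shrink.\<close>

lemma positive_in_UNIV: "positive_in B a \<Longrightarrow> positive_in UNIV a"
proof -
  have "spectrum_in UNIV a \<subseteq> spectrum_in B a"
    unfolding spectrum_in_def by (intro Collect_mono) (metis UNIV_I mem_Times_iff)
  then show "positive_in B a \<Longrightarrow> positive_in UNIV a"
    by (simp add: positive_in_def order_trans)
qed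

theorem theorem2p6:
  fixes D :: "'a :: cstar_algebra set"
    and I :: "'i set" and le :: "'i \<Rightarrow> 'i \<Rightarrow> bool" and u :: "'i \<Rightarrow> 'a"
  assumes "regular_inclusion D" and "masa_inclusion D"
    and "approximate_unit_subalgebra D I le u"
  shows "approximate_unit_algebra I le u"
proof -
  interpret inclusion_with_approximate_unit D I le u
    using assms by unfold_locales (simp_all add: regular_inclusion_def)
  have "((\<lambda>i. u i * n) \<longlongrightarrow> n) (tails I le)" if "n \<in> normalizers D" for n
    using normalizer_adj_mult_self_mem[OF assms(2) adj_normalizer[OF that]]
    by (intro left_unit_limit) (simp add: adj_adj)
  moreover have "a \<in> closure (cspan (normalizers D))" for a
    using assms(1) unfolding regular_inclusion_def by blast
  ultimately have left: "((\<lambda>i. u i * a) \<longlongrightarrow> a) (tails I le)" for a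
    by (rule unit_limit_closure_cspan)
  have right: "((\<lambda>i. a * u i) \<longlongrightarrow> a) (tails I le)" for a
  proof (rule Lim_transform_eventually)
    show "((\<lambda>i. (u i * a\<^sup>\<star>)\<^sup>\<star>) \<longlongrightarrow> a) (tails I le)"
      using tendsto_adj[OF left[of "a\<^sup>\<star>"]] by (simp add: adj_adj)
    show "eventually (\<lambda>i. (u i * a\<^sup>\<star>)\<^sup>\<star> = a * u i) (tails I le)"
      by (rule eventually_mono[OF eventually_index]) (simp add: adj_mult adj_adj adj_unit)
  qed
  have "positive_contractive_net UNIV I le u"
    using assms(3)
    by (simp add: approximate_unit_subalgebra_def positive_contractive_net_def
        positive_in_UNIV[of D])
  with left right show ?thesis
    by (simp add: approximate_unit_algebra_def)
qed

end
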